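(* Let $(X,d)$ be an $n$-point metric space of negative type with $n>1$. Then $$\mathrm{Mag}\,X<n.$$
   Context: For a finite metric space $(X=\{x_1,\dots,x_n\},d)$, let $Z_X=(e^{-d(x_i,x_j)})_{ij}\in M_n(\mathbb{R})$. The space $X$ is of negative type if the metric space $(X,\sqrt{d})$ can be embedded isometrically into a Euclidean space. It is known (Schoenberg, Meckes) that $X$ is of negative type if and only if the matrix $(e^{-t\,d(x_i,x_j)})_{ij}$ is positive definite for all $t>0$; in particular $Z_X$ is then invertible. The magnitude of $X$ is $\mathrm{Mag}\,X=\mathrm{Mag}\,Z_X=\sum_{i,j}(Z_X^{-1})_{ij}$. *)

theory Defs
  imports "HOL-Analysis.Analysis"
begin

text \<open>A finite metric space is a finite type \<open>'a\<close> of points with a metric \<open>d\<close>, that is,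
  \<^term>\<open>Metric_space UNIV d\<close>; the points index the rows and columns of its matrices.

  The Euclidean space in the definition of negative type has arbitrary finite dimension \<open>N\<close>,
  so its points are given by coordinate functions on \<^term>\<open>{..<N}\<close>.\<close>

definition negative_type :: "('a \<Rightarrow> 'a \<Rightarrow> real) \<Rightarrow> bool" where
  "negative_type d \<longleftrightarrow>
     (\<exists>(N::nat) (f :: 'a \<Rightarrow> nat \<Rightarrow> real).
        \<forall>x y. L2_set (\<lambda>i. f x i - f y i) {..<N} = sqrt (d x y))"

definition similarity_matrix :: "('a::finite \<Rightarrow> 'a \<Rightarrow> real) \<Rightarrow> real ^ 'a ^ 'a" where
  "similarity_matrix d = (\<chi> x y. exp (- d x y))"

text \<open>Meaningful only for invertible \<open>A\<close>, as \<^const>\<open>matrix_inv\<close> is unspecified otherwise; the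
  similarity matrix of a finite metric space of negative type is invertible.\<close>

definition matrix_magnitude :: "real ^ 'a ^ 'a::finite \<Rightarrow> real" where
  "matrix_magnitude A = (\<Sum>i\<in>UNIV. \<Sum>j\<in>UNIV. matrix_inv A $ i $ j)"

definition magnitude :: "('a::finite \<Rightarrow> 'a \<Rightarrow> real) \<Rightarrow> real" where
  "magnitude d = matrix_magnitude (similarity_matrix d)"

end

theory Submission
  imports Defs
begin

text \<open>
  Let \<open>A\<close> be the matrix with entries \<open>exp (- d x y / 2)\<close>, so that the similarity matrix \<open>Z\<close> is the
  entrywise square of \<open>A\<close>. The argument is a strict form of an inequality of Vybiral: if \<open>A\<close> is a
  positive semidefinite \<open>n\<close> by \<open>n\<close> matrix with unit diagonal and \<open>J\<close> is the all-ones matrix, then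
  the entrywise square of \<open>A\<close> minus \<open>J / n\<close> is positive semidefinite, which bounds the magnitude of
  that square by \<open>n\<close> when the square is invertible.

  To get the strict bound at once, consider the quadratic form
  \<open>Q X = (\<Sum>x y x' y'. X x y * X x' y' * (A x x' * A y y'))\<close> on matrices \<open>X\<close>, whose matrix is the
  Kronecker product of \<open>A\<close> with itself. Let \<open>w\<close> be the vector of row sums of the inverse of \<open>Z\<close>,
  so that \<open>Z w\<close> is the all-ones vector and the magnitude is the sum of \<open>w\<close>. For
  \<open>X = diag w - A\<inverse>\<close> the three parts of \<open>Q X\<close> are computed as follows: \<open>diag w\<close> contributes the sum of
  \<open>w\<close>, the cross terms contribute minus twice the trace of \<open>diag w\<close> (here the diagonal of \<open>A\<close> is 1),
  and \<open>A\<inverse>\<close> contributes \<open>n\<close>. Hence \<open>Q X = n - Mag\<close> (lemma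
  \<open>kronecker_form_diagonal_minus_inverse\<close>), and it remains to see that \<open>Q\<close> is positive definite and
  that \<open>X \<noteq> 0\<close>. The second holds because the entries of \<open>A\<close> are positive: if \<open>A\<inverse>\<close> were diagonal,
  then so would be \<open>A\<close>, which is impossible for more than one point.

  Negative type says that \<open>d x y\<close> is the squared distance between points \<open>f x\<close> and \<open>f y\<close> of a
  Euclidean space. So \<open>A x x' * A y y'\<close> is the Gaussian kernel evaluated at the points
  \<open>(f x, f y)\<close> and \<open>(f x', f y')\<close> of the product space. These points are pairwise distinct as
  \<open>(x, y)\<close> varies, since \<open>d\<close> is a metric. One fact, the strict positive definiteness of Gaussian
  kernels (lemma \<open>quadratic_form_gaussian_pos\<close>), therefore gives both the positivity of \<open>Q\<close> and the
  invertibility of \<open>A\<close> and \<open>Z\<close>.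
\<close>

section \<open>Strict positive definiteness of Gaussian kernels\<close>

text \<open>Multiplying a kernel by \<open>\<Sum>k. p i k * p j k\<close> amounts to replacing the coefficients \<open>c i\<close> by
  \<open>c i * p i k\<close> and summing over \<open>k\<close>, so nonnegativity for all \<open>c\<close> passes from one power to the
  next. This is the Schur product theorem in the case where one factor is given as a Gram matrix.\<close>

lemma quadratic_form_inner_power_nonneg:
  fixes p :: "'i \<Rightarrow> 'k \<Rightarrow> real"
  shows "0 \<le> (\<Sum>i\<in>I. \<Sum>j\<in>I. c i * c j * (\<Sum>k\<in>K. p i k * p j k) ^ m)"
proof (induction m arbitrary: c)
  case 0
  have "(\<Sum>i\<in>I. \<Sum>j\<in>I. c i * c j) = (\<Sum>i\<in>I. c i)\<^sup>2"
    by (simp add: sum_product power2_eq_square)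
  then show ?case by simp
next
  case (Suc m)
  let ?g = "\<lambda>i j. (\<Sum>k\<in>K. p i k * p j k)"
  have "(\<Sum>i\<in>I. \<Sum>j\<in>I. c i * c j * ?g i j ^ Suc m)
      = (\<Sum>i\<in>I. \<Sum>j\<in>I. \<Sum>k\<in>K. (c i * p i k) * (c j * p j k) * ?g i j ^ m)"
    by (simp add: sum_distrib_left sum_distrib_right mult_ac)
  also have "\<dots> = (\<Sum>k\<in>K. \<Sum>i\<in>I. \<Sum>j\<in>I. (c i * p i k) * (c j * p j k) * ?g i j ^ m)"
    by (subst (2) sum.swap, subst sum.swap) (rule refl)
  also have "\<dots> \<ge> 0"
    by (intro sum_nonneg Suc.IH)
  finally show ?case .
qed

text \<open>The exponential series has nonnegative coefficients.\<close>

lemma quadratic_form_exp_inner_nonneg: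
  fixes p :: "'i \<Rightarrow> 'k \<Rightarrow> real"
  assumes "0 \<le> a"
  shows "0 \<le> (\<Sum>i\<in>I. \<Sum>j\<in>I. c i * c j * exp (a * (\<Sum>k\<in>K. p i k * p j k)))"
proof -
  let ?g = "\<lambda>i j. (\<Sum>k\<in>K. p i k * p j k)"
  have "(\<lambda>m. \<Sum>i\<in>I. \<Sum>j\<in>I. c i * c j * ((a * ?g i j) ^ m /\<^sub>R fact m)) sums
      (\<Sum>i\<in>I. \<Sum>j\<in>I. c i * c j * exp (a * ?g i j))"
    by (intro sums_sum sums_mult exp_converges)
  moreover have "0 \<le> (\<Sum>i\<in>I. \<Sum>j\<in>I. c i * c j * ((a * ?g i j) ^ m /\<^sub>R fact m))" for m
  proof -
    have "(\<Sum>i\<in>I. \<Sum>j\<in>I. c i * c j * ((a * ?g i j) ^ m /\<^sub>R fact m))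
        = a ^ m / fact m * (\<Sum>i\<in>I. \<Sum>j\<in>I. c i * c j * ?g i j ^ m)"
      unfolding power_mult_distrib sum_distrib_left[of "a ^ m / fact m"]
      by (intro sum.cong refl) (simp add: field_simps)
    also have "\<dots> \<ge> 0"
      using assms by (intro mult_nonneg_nonneg quadratic_form_inner_power_nonneg) auto
    finally show ?thesis .
  qed
  ultimately show ?thesis
    by (metis (no_types, lifting) sums_le sums_zero)
qed

text \<open>Adjoining \<open>y\<close> to the family of points, with an arbitrary coefficient \<open>s\<close>, keeps the form
  nonnegative. It is then a quadratic polynomial in \<open>s\<close> without constant term, and its linear
  coefficient, twice the sum in the conclusion, has to vanish.\<close>

lemma exp_inner_combination_vanishes:
  fixes p :: "'i \<Rightarrow> 'k \<Rightarrow> real"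
  assumes "finite I" and "0 \<le> a"
    and null: "(\<Sum>i\<in>I. \<Sum>j\<in>I. c i * c j * exp (a * (\<Sum>k\<in>K. p i k * p j k))) = 0"
  shows "(\<Sum>i\<in>I. c i * exp (a * (\<Sum>k\<in>K. p i k * y k))) = 0"
proof -
  define e where "e x z = exp (a * (\<Sum>k\<in>K. x k * z k))" for x z :: "'k \<Rightarrow> real"
  have e_commute: "e x z = e z x" for x z
    by (simp add: e_def mult.commute)
  define L where "L = (\<Sum>i\<in>I. c i * e (p i) y)"
  have quad: "0 \<le> s\<^sup>2 * e y y + 2 * s * L" for s
  proof -
    \<comment> \<open>The index \<^const>\<open>None\<close> stands for the adjoined point.\<close>
    define c' where "c' = case_option s c"
    define p' where "p' = case_option y p"
    let ?J = "insert None (Some ` I)"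
    have split: "(\<Sum>i\<in>?J. h i) = h None + (\<Sum>i\<in>I. h (Some i))" for h :: "'i option \<Rightarrow> real"
      using \<open>finite I\<close> by (subst sum.insert) (auto simp: sum.reindex)
    have "0 \<le> (\<Sum>i\<in>?J. \<Sum>j\<in>?J. c' i * c' j * e (p' i) (p' j))"
      unfolding e_def by (rule quadratic_form_exp_inner_nonneg[OF \<open>0 \<le> a\<close>])
    also have "\<dots> = s * s * e y y + (\<Sum>j\<in>I. s * c j * e y (p j))
        + ((\<Sum>i\<in>I. c i * s * e (p i) y) + (\<Sum>i\<in>I. \<Sum>j\<in>I. c i * c j * e (p i) (p j)))"
      by (simp add: split sum.distrib c'_def p'_def)
    also have "(\<Sum>i\<in>I. \<Sum>j\<in>I. c i * c j * e (p i) (p j)) = 0"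
      using null by (simp add: e_def)
    also have "(\<Sum>j\<in>I. s * c j * e y (p j)) = s * L"
      by (simp add: L_def sum_distrib_left mult_ac e_commute[of y])
    also have "(\<Sum>i\<in>I. c i * s * e (p i) y) = s * L"
      by (simp add: L_def sum_distrib_left mult_ac)
    finally show ?thesis by (simp add: power2_eq_square algebra_simps)
  qed
  have "e y y > 0" by (simp add: e_def)
  \<comment> \<open>The minimum of the polynomial.\<close>
  have "0 \<le> (- L / e y y)\<^sup>2 * e y y + 2 * (- L / e y y) * L" by (rule quad)
  also have "\<dots> = - (L\<^sup>2 / e y y)"
    using \<open>e y y > 0\<close> by (simp add: field_simps power2_eq_square)
  finally have "L\<^sup>2 / e y y \<le> 0" by simp
  with \<open>e y y > 0\<close> have "L = 0"
    by (simp add: divide_le_0_iff)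
  then show ?thesis by (simp add: L_def e_def)
qed

text \<open>If the form vanishes at \<open>c\<close>, then \<open>\<Sum>i. c i * exp (a * \<langle>p i, y\<rangle>) = 0\<close> for every \<open>y\<close>. Among the
  points with nonzero coefficient take one of maximal norm, \<open>p m\<close>, and put \<open>y = s * p m\<close>. Every
  other such point has a strictly smaller inner product with \<open>p m\<close>, so the term of \<open>m\<close> dominates as
  \<open>s \<rightarrow> \<infinity>\<close> and \<open>c m\<close> has to be 0.\<close>

lemma quadratic_form_exp_inner_pos:
  fixes p :: "'i \<Rightarrow> 'k \<Rightarrow> real"
  assumes "finite I" and "finite K" and "0 < a"
    and distinct: "\<And>i j. i \<in> I \<Longrightarrow> j \<in> I \<Longrightarrow> i \<noteq> j \<Longrightarrow> \<exists>k\<in>K. p i k \<noteq> p j k"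
    and nz: "\<exists>i\<in>I. c i \<noteq> 0"
  shows "0 < (\<Sum>i\<in>I. \<Sum>j\<in>I. c i * c j * exp (a * (\<Sum>k\<in>K. p i k * p j k)))"
proof (rule ccontr)
  define g where "g i j = (\<Sum>k\<in>K. p i k * p j k)" for i j
  assume "\<not> ?thesis"
  then have null: "(\<Sum>i\<in>I. \<Sum>j\<in>I. c i * c j * exp (a * (\<Sum>k\<in>K. p i k * p j k))) = 0"
    using quadratic_form_exp_inner_nonneg[of a c p K I] \<open>0 < a\<close> by simp
  define J where "J = {i \<in> I. c i \<noteq> 0}"
  have J: "finite J" "J \<noteq> {}"
    using \<open>finite I\<close> nz by (auto simp: J_def)
  then obtain m where m: "m \<in> J" "\<And>i. i \<in> J \<Longrightarrow> g i i \<le> g m m"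
  proof -
    have "Max ((\<lambda>i. g i i) ` J) \<in> (\<lambda>i. g i i) ` J"
      using J by (intro Max_in) auto
    then obtain m where "m \<in> J" "g m m = Max ((\<lambda>i. g i i) ` J)" by auto
    then show ?thesis using that[of m] J by simp
  qed
  have less: "g i m < g m m" if "i \<in> J" "i \<noteq> m" for i
  proof -
    have "\<exists>k\<in>K. p i k \<noteq> p m k"
      using distinct[of i m] that m(1) by (simp add: J_def)
    then obtain k where "k \<in> K" "p i k \<noteq> p m k" by blast
    then have "0 < (\<Sum>k\<in>K. (p i k - p m k)\<^sup>2)"
      using \<open>finite K\<close> by (intro sum_pos2[of K k]) auto
    also have "\<dots> = g i i - 2 * g i m + g m m"
      by (simp add: g_def power2_eq_square sum.distrib sum_subtractf sum_distrib_left
          algebra_simps)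
    finally show ?thesis using m(2)[OF that(1)] by simp
  qed
  have zero: "(\<Sum>i\<in>J. c i * exp (a * (g i m - g m m) * s)) = 0" for s
  proof -
    have "(\<Sum>i\<in>I. c i * exp (a * (\<Sum>k\<in>K. p i k * (s * p m k)))) = 0"
      using \<open>finite I\<close> \<open>0 < a\<close> null by (intro exp_inner_combination_vanishes) auto
    then have "(\<Sum>i\<in>I. c i * exp (a * (s * g i m))) = 0"
      by (simp add: g_def sum_distrib_left mult_ac)
    moreover have "(\<Sum>i\<in>I. c i * exp (a * (s * g i m))) = (\<Sum>i\<in>J. c i * exp (a * (s * g i m)))"
      using \<open>finite I\<close> by (intro sum.mono_neutral_right) (auto simp: J_def)
    moreover have "(\<Sum>i\<in>J. c i * exp (a * (g i m - g m m) * s))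
        = exp (- a * s * g m m) * (\<Sum>i\<in>J. c i * exp (a * (s * g i m)))"
      by (simp add: sum_distrib_left exp_add[symmetric] algebra_simps flip: exp_add)
    ultimately show ?thesis by simp
  qed
  have "((\<lambda>s. \<Sum>i\<in>J. c i * exp (a * (g i m - g m m) * s)) \<longlongrightarrow>
      (\<Sum>i\<in>J. c i * (if i = m then 1 else 0))) at_top"
  proof (intro tendsto_sum tendsto_mult tendsto_const)
    fix i assume i: "i \<in> J"
    show "((\<lambda>s. exp (a * (g i m - g m m) * s)) \<longlongrightarrow> (if i = m then 1 else 0)) at_top"
    proof (cases "i = m")
      case False
      then have "a * (g i m - g m m) < 0"
        using less[OF i] \<open>0 < a\<close> by (simp add: mult_pos_neg)
      then have "filterlim (\<lambda>s. a * (g i m - g m m) * s) at_bot at_top"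
        by (simp add: filterlim_tendsto_neg_mult_at_bot[OF tendsto_const] filterlim_ident)
      then show ?thesis
        using False by (simp add: filterlim_compose[OF exp_at_bot])
    qed simp
  qed
  moreover have "(\<Sum>i\<in>J. c i * (if i = m then 1 else 0)) = c m"
    using J(1) m(1) by (simp add: if_distrib[of "\<lambda>x. _ * x"] cong: if_cong)
  ultimately have "((\<lambda>s::real. 0::real) \<longlongrightarrow> c m) at_top"
    by (simp add: zero)
  then have "c m = 0"
    by (simp add: tendsto_const_iff)
  with m(1) show False by (simp add: J_def)
qed

text \<open>Since \<open>|x - y|\<^sup>2 = |x|\<^sup>2 + |y|\<^sup>2 - 2 * \<langle>x, y\<rangle>\<close>, the Gaussian kernel is the exponential of a multiple
  of the inner product, up to positive factors that can be moved into the coefficients.\<close>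

lemma quadratic_form_gaussian_pos:
  fixes p :: "'i \<Rightarrow> 'k \<Rightarrow> real"
  assumes "finite I" and "finite K" and "0 < t"
    and distinct: "\<And>i j. i \<in> I \<Longrightarrow> j \<in> I \<Longrightarrow> i \<noteq> j \<Longrightarrow> \<exists>k\<in>K. p i k \<noteq> p j k"
    and nz: "\<exists>i\<in>I. c i \<noteq> 0"
  shows "0 < (\<Sum>i\<in>I. \<Sum>j\<in>I. c i * c j * exp (- t * (\<Sum>k\<in>K. (p i k - p j k)\<^sup>2)))"
proof -
  define r where "r i = exp (- t * (\<Sum>k\<in>K. (p i k)\<^sup>2))" for i
  have "0 < (\<Sum>i\<in>I. \<Sum>j\<in>I. (c i * r i) * (c j * r j) *
      exp (2 * t * (\<Sum>k\<in>K. p i k * p j k)))"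
    using assms by (intro quadratic_form_exp_inner_pos) (auto simp: r_def)
  also have "\<dots> = (\<Sum>i\<in>I. \<Sum>j\<in>I. c i * c j * exp (- t * (\<Sum>k\<in>K. (p i k - p j k)\<^sup>2)))"
  proof (intro sum.cong refl)
    fix i j
    have "exp (- t * (\<Sum>k\<in>K. (p i k - p j k)\<^sup>2))
        = exp (- t * (\<Sum>k\<in>K. (p i k)\<^sup>2) + - t * (\<Sum>k\<in>K. (p j k)\<^sup>2)
            + 2 * t * (\<Sum>k\<in>K. p i k * p j k))"
      by (simp add: power2_diff sum.distrib sum_subtractf sum_distrib_left sum_negf algebra_simps)
    then show "(c i * r i) * (c j * r j) * exp (2 * t * (\<Sum>k\<in>K. p i k * p j k))
        = c i * c j * exp (- t * (\<Sum>k\<in>K. (p i k - p j k)\<^sup>2))"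
      by (simp only: r_def exp_add mult_ac)
  qed
  finally show ?thesis .
qed

section \<open>The Kronecker form at a diagonal matrix minus an inverse\<close>

lemma invertible_if_quadratic_form_pos:
  fixes A :: "real ^ 'n ^ 'n"
  assumes "\<And>v. v \<noteq> 0 \<Longrightarrow> 0 < (\<Sum>i\<in>UNIV. \<Sum>j\<in>UNIV. v $ i * v $ j * A $ i $ j)"
  shows "invertible A"
proof -
  have "v = 0" if "A *v v = 0" for v
  proof (rule ccontr)
    assume "v \<noteq> 0"
    have "(\<Sum>i\<in>UNIV. \<Sum>j\<in>UNIV. v $ i * v $ j * A $ i $ j) = (\<Sum>i\<in>UNIV. v $ i * (A *v v) $ i)"
      by (simp add: matrix_vector_mult_def sum_distrib_left mult_ac)
    with that assms[OF \<open>v \<noteq> 0\<close>] show False by simp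
  qed
  then show ?thesis
    by (simp add: invertible_left_inverse matrix_left_invertible_ker)
qed

lemma matrix_mul_matrix_inv:
  fixes A :: "'a::semiring_1 ^ 'n ^ 'm"
  assumes "invertible A"
  shows "A ** matrix_inv A = mat 1"
  using someI_ex[OF assms[unfolded invertible_def]] by (simp add: matrix_inv_def)

text \<open>The form is the trace of \<open>A X A X\<^sup>T\<close>. The matrix \<open>Y = A X A\<close> has zero diagonal: the hypothesis on
  \<open>w\<close> says exactly that the diagonal of \<open>A diag(w) A\<close> consists of ones, as does that of
  \<open>A A\<inverse> A = A\<close>. Only the part \<open>- B\<close> of \<open>X\<close> thus contributes.\<close>

lemma kronecker_form_diagonal_minus_inverse:
  fixes A B :: "real ^ 'n ^ 'n" and w :: "'n \<Rightarrow> real"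
  assumes sym: "\<And>i j. A $ i $ j = A $ j $ i"
    and diag: "\<And>i. A $ i $ i = 1"
    and inv: "A ** B = mat 1"
    and weighting: "\<And>i. (\<Sum>j\<in>UNIV. (A $ i $ j)\<^sup>2 * w j) = 1"
  defines "X \<equiv> \<lambda>i k. (if i = k then w i else 0) - B $ i $ k"
  shows "(\<Sum>i\<in>UNIV. \<Sum>k\<in>UNIV. \<Sum>j\<in>UNIV. \<Sum>l\<in>UNIV. X i k * X j l * (A $ i $ j * A $ k $ l))
      = real CARD('n) - (\<Sum>i\<in>UNIV. w i)"
proof -
  have AB: "(\<Sum>j\<in>UNIV. A $ i $ j * B $ j $ k) = (if i = k then 1 else 0)" for i k
    using arg_cong[OF inv, of "\<lambda>M. M $ i $ k"] by (simp add: matrix_matrix_mult_def mat_def)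
  define Y where "Y i k = (\<Sum>j\<in>UNIV. A $ i $ j * w j * A $ k $ j) - A $ i $ k" for i k
  have Y: "(\<Sum>j\<in>UNIV. \<Sum>l\<in>UNIV. X j l * (A $ i $ j * A $ k $ l)) = Y i k" for i k
  proof -
    have "(\<Sum>j\<in>UNIV. \<Sum>l\<in>UNIV. X j l * (A $ i $ j * A $ k $ l))
        = (\<Sum>j\<in>UNIV. \<Sum>l\<in>UNIV. if j = l then A $ i $ j * w j * A $ k $ j else 0)
          - (\<Sum>j\<in>UNIV. \<Sum>l\<in>UNIV. A $ i $ j * B $ j $ l * A $ k $ l)"
      unfolding X_def sum_subtractf[symmetric]
      by (intro sum.cong refl) (auto simp: algebra_simps)
    also have "(\<Sum>j\<in>UNIV. \<Sum>l\<in>UNIV. A $ i $ j * B $ j $ l * A $ k $ l)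
        = (\<Sum>l\<in>UNIV. (\<Sum>j\<in>UNIV. A $ i $ j * B $ j $ l) * A $ k $ l)"
      by (subst sum.swap) (simp add: sum_distrib_right)
    also have "\<dots> = A $ k $ i"
      by (simp add: AB if_distrib[of "\<lambda>x. x * _"] cong: if_cong)
    finally show ?thesis by (simp add: Y_def sym[of k i])
  qed
  have Y_diag: "Y i i = 0" for i
    using weighting[of i] by (simp add: Y_def diag power2_eq_square mult_ac)
  have "(\<Sum>i\<in>UNIV. \<Sum>k\<in>UNIV. \<Sum>j\<in>UNIV. \<Sum>l\<in>UNIV. X i k * X j l * (A $ i $ j * A $ k $ l))
      = (\<Sum>i\<in>UNIV. \<Sum>k\<in>UNIV. X i k * Y i k)"
    by (simp add: Y[symmetric] sum_distrib_left mult.assoc)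
  also have "\<dots> = (\<Sum>i\<in>UNIV. \<Sum>k\<in>UNIV. - (B $ i $ k * Y i k))"
    by (intro sum.cong refl) (auto simp: X_def Y_diag)
  also have "\<dots> = (\<Sum>i\<in>UNIV. \<Sum>k\<in>UNIV. A $ k $ i * B $ i $ k)
      - (\<Sum>i\<in>UNIV. \<Sum>k\<in>UNIV. \<Sum>j\<in>UNIV. A $ j $ i * B $ i $ k * (w j * A $ k $ j))"
    unfolding sum_subtractf[symmetric]
  proof (intro sum.cong refl)
    fix i k
    show "- (B $ i $ k * Y i k) = A $ k $ i * B $ i $ k
      - (\<Sum>j\<in>UNIV. A $ j $ i * B $ i $ k * (w j * A $ k $ j))"
      by (simp add: Y_def sym[of i] sum_distrib_left algebra_simps)
  qed
  also have "(\<Sum>i\<in>UNIV. \<Sum>k\<in>UNIV. A $ k $ i * B $ i $ k) = real CARD('n)"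
    by (subst sum.swap) (simp add: AB)
  also have "(\<Sum>i\<in>UNIV. \<Sum>k\<in>UNIV. \<Sum>j\<in>UNIV. A $ j $ i * B $ i $ k * (w j * A $ k $ j))
      = (\<Sum>k\<in>UNIV. \<Sum>j\<in>UNIV. (\<Sum>i\<in>UNIV. A $ j $ i * B $ i $ k) * (w j * A $ k $ j))"
    unfolding sum_distrib_right by (subst sum.swap) (rule sum.cong[OF refl sum.swap])
  also have "\<dots> = (\<Sum>j\<in>UNIV. w j)"
    by (simp add: AB diag if_distrib[of "\<lambda>x. x * _"] cong: if_cong)
  finally show ?thesis .
qed

section \<open>Magnitude of spaces of negative type\<close>

lemma negative_type_square_distance:
  assumes "negative_type d"
  obtains N and f :: "'a \<Rightarrow> nat \<Rightarrow> real"
  where "\<And>x y. d x y = (\<Sum>i<N. (f x i - f y i)\<^sup>2)"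
proof -
  obtain N and f :: "'a \<Rightarrow> nat \<Rightarrow> real"
    where "\<And>x y. L2_set (\<lambda>i. f x i - f y i) {..<N} = sqrt (d x y)"
    using assms unfolding negative_type_def by blast
  then have "d x y = (\<Sum>i<N. (f x i - f y i)\<^sup>2)" for x y
    by (metis L2_set_def real_sqrt_eq_iff)
  then show ?thesis by (rule that)
qed

theorem theorem1p2:
  fixes d :: "'a::finite \<Rightarrow> 'a \<Rightarrow> real" and n :: nat
  assumes "Metric_space UNIV d"
    and "negative_type d"
    and "CARD('a) = n"
    and "n > 1"
  shows "magnitude d < real n"
proof -
  interpret Metric_space UNIV d by fact
  obtain N and f :: "'a \<Rightarrow> nat \<Rightarrow> real"
    where d: "\<And>x y. d x y = (\<Sum>i<N. (f x i - f y i)\<^sup>2)"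
    using negative_type_square_distance[OF assms(2)] by blast
  have f_distinct: "\<exists>i\<in>{..<N}. f x i \<noteq> f y i" if "x \<noteq> y" for x y
  proof (rule ccontr)
    assume "\<not> ?thesis"
    then have "d x y = 0" by (simp add: d)
    with that show False by simp
  qed

  define S where "S t = (\<chi> x y. exp (- t * d x y))" for t :: real
  have S_invertible: "invertible (S t)" if "0 < t" for t
  proof (rule invertible_if_quadratic_form_pos)
    fix v :: "real ^ 'a" assume "v \<noteq> 0"
    then have "\<exists>x. v $ x \<noteq> 0" by (simp add: vec_eq_iff)
    then show "0 < (\<Sum>x\<in>UNIV. \<Sum>y\<in>UNIV. v $ x * v $ y * S t $ x $ y)"
      using quadratic_form_gaussian_pos[of UNIV "{..<N}" t f "\<lambda>x. v $ x"] that f_distinct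
      by (simp add: S_def d)
  qed
  have Z: "similarity_matrix d = S 1"
    by (simp add: similarity_matrix_def S_def)
  define A where "A = S (1/2)"
  define B where "B = matrix_inv A"
  have AB: "A ** B = mat 1"
    using S_invertible[of "1/2"] by (simp add: A_def B_def matrix_mul_matrix_inv)
  define w where "w x = (\<Sum>y\<in>UNIV. matrix_inv (S 1) $ x $ y)" for x
  have mag: "magnitude d = (\<Sum>x\<in>UNIV. w x)"
    by (simp add: magnitude_def matrix_magnitude_def Z w_def)
  have A_square: "(A $ x $ y)\<^sup>2 = S 1 $ x $ y" for x y
    by (simp add: A_def S_def flip: exp_double)
  have weighting: "(\<Sum>y\<in>UNIV. (A $ x $ y)\<^sup>2 * w y) = 1" for x
  proof -
    have "(\<Sum>y\<in>UNIV. (A $ x $ y)\<^sup>2 * w y)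
        = (\<Sum>z\<in>UNIV. (S 1 ** matrix_inv (S 1)) $ x $ z)"
      unfolding A_square w_def matrix_matrix_mult_def
      by (simp add: sum_distrib_left) (rule sum.swap)
    then show ?thesis
      using S_invertible[of 1] by (simp add: matrix_mul_matrix_inv mat_def)
  qed
  define X where "X x y = (if x = y then w x else 0) - B $ x $ y" for x y

  have "\<exists>x y. X x y \<noteq> 0"
  proof (rule ccontr)
    assume "\<not> ?thesis"
    then have B: "B $ x $ y = (if x = y then w x else 0)" for x y
      by (simp add: X_def split: if_splits)
    have *: "A $ x $ y * w y = (if x = y then 1 else 0)" for x y
      using arg_cong[OF AB, of "\<lambda>M. M $ x $ y"]
      by (simp add: matrix_matrix_mult_def mat_def B if_distrib[of "\<lambda>x. _ * x"] cong: if_cong)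
    obtain x y :: 'a where "x \<noteq> y"
      using assms(3,4) card_le_Suc0_iff_eq[of "UNIV :: 'a set"] by auto
    then show False
      using *[of x y] *[of y y] by (simp add: A_def S_def)
  qed
  then obtain x0 y0 where nz: "X x0 y0 \<noteq> 0" by blast

  have sum_pairs: "(\<Sum>u\<in>UNIV. h u) = (\<Sum>x\<in>UNIV. \<Sum>y\<in>UNIV. h (x, y))"
    for h :: "'a \<times> 'a \<Rightarrow> real"
    by (simp add: sum.cartesian_product)
  \<comment> \<open>The point \<open>(f x, f y)\<close> of the product space, with coordinates indexed by a disjoint sum.\<close>
  define q where "q = (\<lambda>(x, y). case_sum (f x) (f y))"
  have "0 < (\<Sum>u\<in>UNIV. \<Sum>v\<in>UNIV. case_prod X u * case_prod X v *
      exp (- (1/2) * (\<Sum>k\<in>{..<N} <+> {..<N}. (q u k - q v k)\<^sup>2)))"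
  proof (rule quadratic_form_gaussian_pos)
    fix u v :: "'a \<times> 'a" assume "u \<noteq> v"
    then consider "fst u \<noteq> fst v" | "snd u \<noteq> snd v" by (auto simp: prod_eq_iff)
    then show "\<exists>k\<in>{..<N} <+> {..<N}. q u k \<noteq> q v k"
    proof cases
      case 1
      then obtain k where "k < N" "f (fst u) k \<noteq> f (fst v) k" using f_distinct by blast
      then show ?thesis by (intro bexI[of _ "Inl k"]) (auto simp: q_def split_beta)
    next
      case 2
      then obtain k where "k < N" "f (snd u) k \<noteq> f (snd v) k" using f_distinct by blast
      then show ?thesis by (intro bexI[of _ "Inr k"]) (auto simp: q_def split_beta)
    qed
  qed (use nz in auto)
  also have "\<dots> = (\<Sum>u\<in>UNIV. \<Sum>v\<in>UNIV. case_prod X u * case_prod X v *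
      (A $ fst u $ fst v * A $ snd u $ snd v))"
    by (intro sum.cong refl)
       (simp add: q_def split_beta sum.Plus A_def S_def d algebra_simps flip: exp_add)
  also have "\<dots> = (\<Sum>x\<in>UNIV. \<Sum>y\<in>UNIV. \<Sum>x'\<in>UNIV. \<Sum>y'\<in>UNIV.
      X x y * X x' y' * (A $ x $ x' * A $ y $ y'))"
    by (simp add: sum_pairs)
  also have "\<dots> = real n - magnitude d"
    unfolding X_def mag assms(3)[symmetric]
    by (rule kronecker_form_diagonal_minus_inverse[OF _ _ AB weighting])
       (simp_all add: A_def S_def commute)
  finally show ?thesis by simp
qed

end
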